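(* Let $1<d_1<d_2<d_3$ be integers with $\gcd(d_1,d_2)=1$ such that $\{d_1,d_2,d_3\}$ is a minimal generating set of the semigroup $S(d_1,d_2,d_3)$. Let $a_{33}=\min\{v\ge2: vd_3=v_1d_1+v_2d_2,\ v_1,v_2\in\mathbb Z_{\ge0}\}$. For $1\le k<a_{33}$ write $kd_3=d_1d_2-p_{kd_3}d_1-q_{kd_3}d_2$ with integers $p_{kd_3},q_{kd_3}\ge1$, and set $\Omega^k=\{u_1d_1+u_2d_2+kd_3:\ 0\le u_1\le p_{kd_3}-1,\ 0\le u_2\le q_{kd_3}-1\}$. Then $$\Delta(d_1,d_2,d_3)=\Delta(d_1,d_2)\setminus\bigcup_{k=1}^{a_{33}-1}\Omega^k.$$
   Context: $S(d_1,d_2,d_3)$ is the set of nonnegative integer combinations of $d_1,d_2,d_3$; minimal means no $d_i$ is a nonnegative integer combination of the other two. For a tuple of positive integers, $\Delta(\cdot)$ denotes the set of positive integers not representable as nonnegative integer combinations of its entries. For $\gcd(d_1,d_2)=1$, every $t\in\Delta(d_1,d_2)$ has a unique representation $t=d_1d_2-pd_1-qd_2$ with $1\le p\le\lfloor d_2-d_2/d_1\rfloor$, $1\le q\le d_1-1$; and $kd_3\in\Delta(d_1,d_2)$ for $1\le k<a_{33}$. *)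

theory Defs
  imports Main
begin

text \<open>The generators are passed as a set; this agrees with the tuple formulation because only
  finite sets of pairwise distinct generators are used (a sum over an infinite set would be 0).\<close>

definition gen_semigroup :: "nat set \<Rightarrow> nat set" where
  "gen_semigroup D = {\<Sum>d\<in>D. c d * d | c. True}"

definition minimal_generators :: "nat set \<Rightarrow> bool" where
  "minimal_generators D \<longleftrightarrow> (\<forall>d\<in>D. d \<notin> gen_semigroup (D - {d}))"

definition gaps :: "nat set \<Rightarrow> nat set" where
  "gaps D = {t. 0 < t \<and> t \<notin> gen_semigroup D}"

definition a33 :: "nat \<Rightarrow> nat \<Rightarrow> nat \<Rightarrow> nat" where
  "a33 d1 d2 d3 = (LEAST v. 2 \<le> v \<and> (\<exists>v1 v2. v * d3 = v1 * d1 + v2 * d2))"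

definition gap_rep :: "nat \<Rightarrow> nat \<Rightarrow> nat \<Rightarrow> nat \<times> nat \<Rightarrow> bool" where
  "gap_rep d1 d2 t = (\<lambda>(p, q). 1 \<le> p \<and> 1 \<le> q \<and>
     int t = int d1 * int d2 - int p * int d1 - int q * int d2)"

text \<open>The pair \<open>(p\<^sub>t, q\<^sub>t)\<close>; see \<open>gap_rep_ex1\<close> and \<open>multiple_in_gaps\<close> below for
  well-definedness.\<close>

definition gap_coeffs :: "nat \<Rightarrow> nat \<Rightarrow> nat \<Rightarrow> nat \<times> nat" where
  "gap_coeffs d1 d2 t = (THE pq. gap_rep d1 d2 t pq)"

definition Omega :: "nat \<Rightarrow> nat \<Rightarrow> nat \<Rightarrow> nat \<Rightarrow> nat set" where
  "Omega d1 d2 d3 k =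
     (case gap_coeffs d1 d2 (k * d3) of (p, q) \<Rightarrow>
        {u1 * d1 + u2 * d2 + k * d3 | u1 u2. u1 < p \<and> u2 < q})"

lemma gen_semigroup_pair:
  assumes "d1 \<noteq> d2"
  shows "t \<in> gen_semigroup {d1, d2} \<longleftrightarrow> (\<exists>u1 u2. t = u1 * d1 + u2 * d2)"
proof
  assume "t \<in> gen_semigroup {d1, d2}"
  then show "\<exists>u1 u2. t = u1 * d1 + u2 * d2"
    using assms by (auto simp: gen_semigroup_def)
next
  assume "\<exists>u1 u2. t = u1 * d1 + u2 * d2"
  then obtain u1 u2 where "t = u1 * d1 + u2 * d2" by blast
  then have "t = (\<Sum>d\<in>{d1, d2}. (if d = d1 then u1 else u2) * d)"
    using assms by auto
  then show "t \<in> gen_semigroup {d1, d2}"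
    unfolding gen_semigroup_def by (intro CollectI exI[of _ "\<lambda>d. if d = d1 then u1 else u2"]) simp
qed

lemma gap_rep_ex1:
  assumes d: "1 < d1" "d1 < d2" and cop: "coprime d1 d2" and t: "t \<in> gaps {d1, d2}"
  shows "\<exists>!pq. gap_rep d1 d2 t pq"
proof (rule ex_ex1I)
  have nrep: "t \<noteq> u1 * d1 + u2 * d2" for u1 u2
    using t gen_semigroup_pair[of d1 d2 t] d by (auto simp: gaps_def)
  have nrepi: "int t \<noteq> x * int d1 + y * int d2" if "0 \<le> x" "0 \<le> y" for x y
  proof
    assume "int t = x * int d1 + y * int d2"
    then have "int t = int (nat x * d1 + nat y * d2)" using that by simp
    then show False using nrep by (metis of_nat_eq_iff)
  qed
  obtain u v where "u * int d1 + v * int d2 = gcd (int d1) (int d2)"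
    using bezout_int by blast
  then have uv: "u * int d1 + v * int d2 = 1"
    using cop by (metis coprime_imp_gcd_eq_1 coprime_int_iff)
  define B where "B = int t * v"
  define q where "q = (- B) mod int d1"
  have "int d1 dvd B + q"
    unfolding q_def by (intro mod_0_imp_dvd) (simp add: mod_simps)
  then obtain c where c: "B + q = int d1 * c" by blast
  have q: "0 \<le> q" "q < int d1" unfolding q_def using d by auto
  have t_eq: "int t = (int t * u + int d2 * c) * int d1 - q * int d2"
  proof -
    have "int t = int t * (u * int d1 + v * int d2)" by (simp add: uv)
    also have "\<dots> = int t * u * int d1 + B * int d2" by (simp add: B_def algebra_simps)
    also have "B = int d1 * c - q" using c by simp
    finally show ?thesis by (simp add: algebra_simps)
  qed
  define n where "n = int t * u + int d2 * c"
  have tn: "int t = n * int d1 - q * int d2" using t_eq n_def by simp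
  have "n < int d2"
  proof (rule ccontr)
    assume "\<not> n < int d2"
    moreover have "int t = (n - int d2) * int d1 + (int d1 - q) * int d2"
      using tn by (simp add: algebra_simps)
    ultimately show False using nrepi[of "n - int d2" "int d1 - q"] q by simp
  qed
  moreover have "0 \<le> n"
  proof (rule ccontr)
    assume "\<not> 0 \<le> n"
    then have "n * int d1 \<le> 0" by (simp add: mult_nonpos_nonneg)
    moreover have "0 \<le> q * int d2" using q by simp
    moreover have "0 < t" using t by (simp add: gaps_def)
    ultimately show False using tn by linarith
  qed
  moreover have "q \<noteq> 0"
  proof
    assume "q = 0"
    then show False using tn nrepi[of n 0] \<open>0 \<le> n\<close> by simp
  qed
  ultimately have "gap_rep d1 d2 t (nat (int d2 - n), nat q)"
    using q tn by (auto simp: gap_rep_def algebra_simps Suc_le_eq)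
  then show "\<exists>pq. gap_rep d1 d2 t pq" by blast
next
  fix x y assume x: "gap_rep d1 d2 t x" and y: "gap_rep d1 d2 t y"
  obtain p q where xe: "x = (p, q)" by fastforce
  obtain p' q' where ye: "y = (p', q')" by fastforce
  have e1: "t + p * d1 + q * d2 = d1 * d2"
  proof -
    have "int (t + p * d1 + q * d2) = int (d1 * d2)" using x xe by (simp add: gap_rep_def)
    then show ?thesis by (metis of_nat_eq_iff)
  qed
  have e2: "t + p' * d1 + q' * d2 = d1 * d2"
  proof -
    have "int (t + p' * d1 + q' * d2) = int (d1 * d2)" using y ye by (simp add: gap_rep_def)
    then show ?thesis by (metis of_nat_eq_iff)
  qed
  have tp: "0 < t" using t by (simp add: gaps_def)
  have "q * d2 < d1 * d2" "q' * d2 < d1 * d2" using e1 e2 tp by linarith+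
  then have lt: "q < d1" "q' < d1" by auto
  have "int d1 * (int p - int p') = (int q' - int q) * int d2"
  proof -
    have "int (t + p * d1 + q * d2) = int (t + p' * d1 + q' * d2)" using e1 e2 by simp
    then show ?thesis by (simp add: algebra_simps)
  qed
  then have "int d1 dvd (int q' - int q) * int d2" by (metis dvd_triv_left)
  then have "int d1 dvd int q' - int q"
    using cop by (simp add: coprime_dvd_mult_left_iff)
  moreover have "\<bar>int q' - int q\<bar> < int d1" using lt by linarith
  ultimately have qq: "q' = q" using dvd_imp_le_int[of "int q' - int q" "int d1"] by fastforce
  have "p = p'"
  proof -
    have "p * d1 = p' * d1" using e1 e2[unfolded qq] by linarith
    then show ?thesis using d by simp
  qed
  then show "x = y" using xe ye qq by simp
qed

lemma multiple_in_gaps: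
  assumes d: "1 < d1" "d1 < d2" "d2 < d3" and min: "minimal_generators {d1, d2, d3}"
    and k: "1 \<le> k" "k < a33 d1 d2 d3"
  shows "k * d3 \<in> gaps {d1, d2}"
proof -
  have "k * d3 \<notin> gen_semigroup {d1, d2}"
  proof (cases "k = 1")
    case True
    have "{d1, d2, d3} - {d3} = {d1, d2}" using d by auto
    then show ?thesis using min True by (auto simp: minimal_generators_def)
  next
    case False
    then show ?thesis
      using k not_less_Least[of k "\<lambda>v. 2 \<le> v \<and> (\<exists>v1 v2. v * d3 = v1 * d1 + v2 * d2)"] d
      by (auto simp: a33_def gen_semigroup_pair)
  qed
  then show ?thesis using k d by (simp add: gaps_def)
qed

lemma gap_coeffs_rep:
  assumes "1 < d1" "d1 < d2" "d2 < d3" "coprime d1 d2" "minimal_generators {d1, d2, d3}"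
    and "1 \<le> k" "k < a33 d1 d2 d3"
  shows "gap_rep d1 d2 (k * d3) (gap_coeffs d1 d2 (k * d3))"
  unfolding gap_coeffs_def
  using theI'[OF gap_rep_ex1] multiple_in_gaps assms by blast

lemma a33_attained:
  assumes "1 < d1"
  shows "2 \<le> a33 d1 d2 d3 \<and> (\<exists>v1 v2. a33 d1 d2 d3 * d3 = v1 * d1 + v2 * d2)"
  unfolding a33_def
proof (rule LeastI[of _ d1])
  show "2 \<le> d1 \<and> (\<exists>v1 v2. d1 * d3 = v1 * d1 + v2 * d2)"
    using assms by (auto intro: exI[of _ d3] exI[of _ 0])
qed

end

theory Submission
  imports Defs
begin

text \<open>In a representation \<open>t = u\<^sub>1d\<^sub>1 + u\<^sub>2d\<^sub>2 + kd\<^sub>3\<close> one may assume \<open>k < a\<^sub>3\<^sub>3\<close>, since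
  \<open>a\<^sub>3\<^sub>3d\<^sub>3\<close> is a combination of \<open>d\<^sub>1\<close> and \<open>d\<^sub>2\<close>. For \<open>k \<ge> 1\<close>, substituting
  \<open>kd\<^sub>3 = d\<^sub>1d\<^sub>2 - pd\<^sub>1 - qd\<^sub>2\<close> shows that \<open>t\<close> is a combination of \<open>d\<^sub>1\<close> and \<open>d\<^sub>2\<close> as soon as
  \<open>u\<^sub>1 \<ge> p\<close> or \<open>u\<^sub>2 \<ge> q\<close>; so a gap of \<open>{d\<^sub>1, d\<^sub>2}\<close> represented in this way lies in \<open>\<Omega>\<^sup>k\<close>.\<close>

lemma gen_semigroup_triple:
  assumes "d1 \<noteq> d2" "d1 \<noteq> d3" "d2 \<noteq> d3"
  shows "t \<in> gen_semigroup {d1, d2, d3} \<longleftrightarrow> (\<exists>u1 u2 k. t = u1 * d1 + u2 * d2 + k * d3)"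
proof
  assume "t \<in> gen_semigroup {d1, d2, d3}"
  then obtain c where "t = (\<Sum>d\<in>{d1, d2, d3}. c d * d)"
    by (auto simp: gen_semigroup_def)
  then have "t = c d1 * d1 + c d2 * d2 + c d3 * d3"
    using assms by simp
  then show "\<exists>u1 u2 k. t = u1 * d1 + u2 * d2 + k * d3" by blast
next
  assume "\<exists>u1 u2 k. t = u1 * d1 + u2 * d2 + k * d3"
  then obtain u1 u2 k where "t = u1 * d1 + u2 * d2 + k * d3" by blast
  then have "t = (\<Sum>d\<in>{d1, d2, d3}. (if d = d1 then u1 else if d = d2 then u2 else k) * d)"
    using assms by auto
  then show "t \<in> gen_semigroup {d1, d2, d3}"
    unfolding gen_semigroup_def
    by (intro CollectI exI[of _ "\<lambda>d. if d = d1 then u1 else if d = d2 then u2 else k"]) simp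
qed

text \<open>Trading \<open>a33\<close> copies of \<open>d3\<close> for \<open>v1\<close> copies of
  \<open>d1\<close> and \<open>v2\<close> of \<open>d2\<close> strictly lowers \<open>k\<close>, as
  \<open>a33\<close> is at least 2. The coefficients \<open>u1\<close>, \<open>u2\<close> absorb the
  trade, so the induction generalises over them.\<close>

lemma representation_below_a33:
  assumes "1 < d1"
  shows "\<exists>w1 w2 j. u1 * d1 + u2 * d2 + k * d3 = w1 * d1 + w2 * d2 + j * d3 \<and> j < a33 d1 d2 d3"
proof (induction k arbitrary: u1 u2 rule: less_induct)
  case (less k)
  obtain v1 v2 where v: "a33 d1 d2 d3 * d3 = v1 * d1 + v2 * d2" and a: "2 \<le> a33 d1 d2 d3"
    using a33_attained[OF assms] by blast
  show ?case
  proof (cases "k < a33 d1 d2 d3")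
    case True
    then show ?thesis by blast
  next
    case False
    then obtain l where k: "k = l + a33 d1 d2 d3"
      by (metis add.commute le_Suc_ex linorder_not_less)
    have "u1 * d1 + u2 * d2 + k * d3 = (u1 + v1) * d1 + (u2 + v2) * d2 + l * d3"
      using v unfolding k add_mult_distrib by linarith
    then show ?thesis
      using less.IH[of l "u1 + v1" "u2 + v2"] k a by auto
  qed
qed

text \<open>Substituting for \<open>m\<close> gives
  \<open>(u1 - p) * d1 + (d1 - q + u2) * d2\<close>, and \<open>rep\<close> forces
  \<open>q \<le> d1\<close>. Here \<open>m\<close> stands for \<open>k * d3\<close>; leaving
  \<open>d1\<close> and \<open>d2\<close> unordered allows a use with their roles exchanged.\<close>

lemma pair_representation_of_shift:
  fixes d1 d2 m p q u1 u2 :: nat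
  assumes rep: "m + p * d1 + q * d2 = d1 * d2" and "0 < d2" and u: "p \<le> u1"
  shows "\<exists>w1 w2. u1 * d1 + u2 * d2 + m = w1 * d1 + w2 * d2"
proof -
  have "q * d2 \<le> d1 * d2" using rep by linarith
  then have "q \<le> d1" using \<open>0 < d2\<close> by simp
  then obtain r where r: "d1 = q + r" by (metis le_Suc_ex)
  obtain s where s: "u1 = p + s" using u by (metis le_Suc_ex)
  have "d1 * d2 = q * d2 + r * d2" using r by (metis add_mult_distrib)
  moreover have "u1 * d1 = p * d1 + s * d1" using s by (metis add_mult_distrib)
  ultimately have "u1 * d1 + u2 * d2 + m = s * d1 + (r + u2) * d2"
    using rep unfolding add_mult_distrib by linarith
  then show ?thesis by blast
qed

theorem theorem2:
  fixes d1 d2 d3 :: nat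
  assumes "1 < d1" and "d1 < d2" and "d2 < d3"
    and "gcd d1 d2 = 1"
    and "minimal_generators {d1, d2, d3}"
  shows "gaps {d1, d2, d3} = gaps {d1, d2} - (\<Union>k\<in>{1..a33 d1 d2 d3 - 1}. Omega d1 d2 d3 k)"
proof -
  have pair: "t \<in> gen_semigroup {d1, d2} \<longleftrightarrow> (\<exists>u1 u2. t = u1 * d1 + u2 * d2)" for t
    using assms by (intro gen_semigroup_pair) simp
  have triple: "t \<in> gen_semigroup {d1, d2, d3} \<longleftrightarrow> (\<exists>u1 u2 k. t = u1 * d1 + u2 * d2 + k * d3)" for t
    using assms by (intro gen_semigroup_triple) simp_all
  have pair_triple: "gen_semigroup {d1, d2} \<subseteq> gen_semigroup {d1, d2, d3}"
  proof
    fix t assume "t \<in> gen_semigroup {d1, d2}"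
    then obtain u1 u2 where "t = u1 * d1 + u2 * d2 + 0 * d3" by (auto simp: pair)
    then show "t \<in> gen_semigroup {d1, d2, d3}" unfolding triple by blast
  qed
  \<comment> \<open>This holds for every \<open>k\<close>, whatever pair \<open>gap_coeffs\<close>
    yields: each element is written as a combination.\<close>
  have Omega_triple: "Omega d1 d2 d3 k \<subseteq> gen_semigroup {d1, d2, d3}" for k
    unfolding Omega_def triple subset_iff by (simp split: prod.split) blast
  have "\<exists>k\<in>{1..a33 d1 d2 d3 - 1}. t \<in> Omega d1 d2 d3 k"
    if rt: "t \<in> gen_semigroup {d1, d2, d3}" and nt: "t \<notin> gen_semigroup {d1, d2}" for t
  proof -
    obtain u1 u2 k where t: "t = u1 * d1 + u2 * d2 + k * d3" and k: "k < a33 d1 d2 d3"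
      using rt representation_below_a33[OF \<open>1 < d1\<close>] unfolding triple by metis
    have "k \<noteq> 0" using nt t unfolding pair by (metis add.right_neutral mult_zero_left)
    then have k1: "1 \<le> k" by simp
    obtain p q where pq: "gap_coeffs d1 d2 (k * d3) = (p, q)" by fastforce
    have "gap_rep d1 d2 (k * d3) (p, q)"
      using gap_coeffs_rep[of d1 d2 d3 k] assms k k1 pq by (simp add: coprime_iff_gcd_eq_1)
    then have "int (k * d3 + p * d1 + q * d2) = int (d1 * d2)"
      by (simp add: gap_rep_def)
    then have rep: "k * d3 + p * d1 + q * d2 = d1 * d2"
      by (simp only: of_nat_eq_iff)
    have "u1 < p"
    proof (rule ccontr)
      assume "\<not> u1 < p"
      then show False
        using pair_representation_of_shift[OF rep, of u1 u2] assms nt t by (auto simp: pair)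
    qed
    moreover have "u2 < q"
    proof (rule ccontr)
      assume "\<not> u2 < q"
      \<comment> \<open>The case \<open>q \<le> u2\<close> is the mirror image, with
        \<open>d1\<close>, \<open>p\<close>, \<open>u1\<close> and \<open>d2\<close>,
        \<open>q\<close>, \<open>u2\<close> exchanged.\<close>
      moreover have "k * d3 + q * d2 + p * d1 = d2 * d1" using rep by (simp add: ac_simps)
      ultimately obtain w1 w2 where "u2 * d2 + u1 * d1 + k * d3 = w1 * d2 + w2 * d1"
        using pair_representation_of_shift[of "k * d3" q d2 p d1 u2 u1] assms by auto
      then have "t = w2 * d1 + w1 * d2" using t by linarith
      then show False using nt by (auto simp: pair)
    qed
    ultimately have "t \<in> Omega d1 d2 d3 k" using t by (auto simp: Omega_def pq)
    then show ?thesis using k k1 by (intro bexI[of _ k]) auto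
  qed
  \<comment> \<open>The two inclusions of semigroups give one direction, the fact just proved the
    other.\<close>
  then show ?thesis using pair_triple Omega_triple unfolding gaps_def by blast
qed

end
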